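(* There does not exist a non-geodesic timelike horizontal biharmonic curve (parametrized by arclength) in $\mathcal{HH}_3$.
   Context: $\mathcal{HH}_3=(\mathbb{R}^3,g)$ is the 3-dimensional hyperbolic Heisenberg group with the semi-Riemannian metric $g=(dx)^2-(dy)^2-\frac14(dz+2y\,dx-2x\,dy)^2$ and Levi-Civita connection $\nabla$. The frame $e_1=\partial_x-2y\,\partial_z$, $e_2=\partial_y+2x\,\partial_z$, $e_3=2\,\partial_z$ is orthonormal, with $g(e_1,e_1)=1$, $g(e_2,e_2)=g(e_3,e_3)=-1$. Curvature: $R(X,Y)Z=\nabla_X\nabla_YZ-\nabla_Y\nabla_XZ-\nabla_{[X,Y]}Z$. Curves are smooth and defined on an open interval. A curve $\gamma(s)=(x(s),y(s),z(s))$ is timelike and parametrized by arclength if $T=\gamma'$ satisfies $g(T,T)=-1$. It is biharmonic if $\nabla_T\nabla_T\nabla_TT-R(T,\nabla_TT)T=0$. It is horizontal if $\gamma'(s)\in\ker w$ for all $s$, where $w=dz+2y\,dx-2x\,dy$; equivalently $z'+2x'y-2xy'=0$, i.e. $\gamma'=x'e_1+y'e_2$. Standing assumption (existence of an orthonormal Frenet frame): the curves considered have $\nabla_TT$ nowhere zero ("non-geodesic") and nowhere null. *)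

theory Defs
  imports "HOL-Analysis.Analysis"
begin

section \<open>The hyperbolic Heisenberg group\<close>

text \<open>Points and tangent vectors are both coordinate triples \<open>(x, y, z)\<close> in \<open>real ^ 3\<close>,
  and a vector field is its coordinate-component function.\<close>

definition hh_w :: "real ^ 3 \<Rightarrow> real ^ 3 \<Rightarrow> real" where
  "hh_w p u = u $ 3 + 2 * p $ 2 * u $ 1 - 2 * p $ 1 * u $ 2"

definition hh_g :: "real ^ 3 \<Rightarrow> real ^ 3 \<Rightarrow> real ^ 3 \<Rightarrow> real" where
  "hh_g p u v = u $ 1 * v $ 1 - u $ 2 * v $ 2 - 1 / 4 * hh_w p u * hh_w p v"

definition hh_gram :: "real ^ 3 \<Rightarrow> real ^ 3 ^ 3" where
  "hh_gram p = (\<chi> i j. hh_g p (axis i 1) (axis j 1))"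

definition partial :: "3 \<Rightarrow> (real ^ 3 \<Rightarrow> real) \<Rightarrow> real ^ 3 \<Rightarrow> real" where
  "partial i f p = deriv (\<lambda>t. f (p + t *\<^sub>R axis i 1)) 0"

text \<open>The Christoffel symbols \<open>\<Gamma>\<^sup>k\<^sub>i\<^sub>j\<close> of the Levi-Civita connection of \<open>hh_g\<close>,
  written \<open>hh_Gamma p k i j\<close>.\<close>

definition hh_Gamma :: "real ^ 3 \<Rightarrow> 3 \<Rightarrow> 3 \<Rightarrow> 3 \<Rightarrow> real" where
  "hh_Gamma p k i j = 1 / 2 * (\<Sum>l\<in>UNIV. matrix_inv (hh_gram p) $ k $ l *
     (partial i (\<lambda>q. hh_gram q $ j $ l) p
      + partial j (\<lambda>q. hh_gram q $ i $ l) p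
      - partial l (\<lambda>q. hh_gram q $ i $ j) p))"

definition hh_nabla ::
  "(real ^ 3 \<Rightarrow> real ^ 3) \<Rightarrow> (real ^ 3 \<Rightarrow> real ^ 3) \<Rightarrow> real ^ 3 \<Rightarrow> real ^ 3" where
  "hh_nabla X Y p = (\<chi> k. (\<Sum>i\<in>UNIV. X p $ i * partial i (\<lambda>q. Y q $ k) p)
     + (\<Sum>i\<in>UNIV. \<Sum>j\<in>UNIV. hh_Gamma p k i j * X p $ i * Y p $ j))"

definition lie_bracket ::
  "(real ^ 3 \<Rightarrow> real ^ 3) \<Rightarrow> (real ^ 3 \<Rightarrow> real ^ 3) \<Rightarrow> real ^ 3 \<Rightarrow> real ^ 3" where
  "lie_bracket X Y p = (\<chi> k. \<Sum>i\<in>UNIV. X p $ i * partial i (\<lambda>q. Y q $ k) p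
     - Y p $ i * partial i (\<lambda>q. X q $ k) p)"

definition hh_curvature_field ::
  "(real ^ 3 \<Rightarrow> real ^ 3) \<Rightarrow> (real ^ 3 \<Rightarrow> real ^ 3) \<Rightarrow> (real ^ 3 \<Rightarrow> real ^ 3) \<Rightarrow> real ^ 3 \<Rightarrow> real ^ 3" where
  "hh_curvature_field X Y Z p =
     hh_nabla X (hh_nabla Y Z) p - hh_nabla Y (hh_nabla X Z) p - hh_nabla (lie_bracket X Y) Z p"

text \<open>By tensoriality, the curvature at \<open>p\<close> depends only on the values of the three fields at \<open>p\<close>,
  so on tangent vectors it may be evaluated through any smooth extensions; here, the extensions
  with constant components in the coordinate frame.\<close>

definition hh_R :: "real ^ 3 \<Rightarrow> real ^ 3 \<Rightarrow> real ^ 3 \<Rightarrow> real ^ 3 \<Rightarrow> real ^ 3" where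
  "hh_R p u v w = hh_curvature_field (\<lambda>_. u) (\<lambda>_. v) (\<lambda>_. w) p"

section \<open>Curves\<close>

definition velocity :: "(real \<Rightarrow> real ^ 3) \<Rightarrow> real \<Rightarrow> real ^ 3" where
  "velocity f s = vector_derivative f (at s)"

text \<open>Curves are total functions, of which only the values on an open interval \<open>I\<close> matter: all the
  derivatives below are taken at points of \<open>I\<close>, hence depend only on the restriction to \<open>I\<close>.\<close>

definition smooth_curve_on :: "real set \<Rightarrow> (real \<Rightarrow> real ^ 3) \<Rightarrow> bool" where
  "smooth_curve_on I \<gamma> \<longleftrightarrow> (\<forall>n. \<forall>s\<in>I. (velocity ^^ n) \<gamma> differentiable (at s))"

text \<open>The covariant derivative \<open>\<nabla>\<^sub>T V\<close> along \<open>\<gamma>\<close> of a vector field \<open>V\<close> along \<open>\<gamma>\<close>, \<open>T = \<gamma>'\<close>.\<close>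

definition hh_nabla_along ::
  "(real \<Rightarrow> real ^ 3) \<Rightarrow> (real \<Rightarrow> real ^ 3) \<Rightarrow> real \<Rightarrow> real ^ 3" where
  "hh_nabla_along \<gamma> V s = (\<chi> k. velocity V s $ k
     + (\<Sum>i\<in>UNIV. \<Sum>j\<in>UNIV. hh_Gamma (\<gamma> s) k i j * velocity \<gamma> s $ i * V s $ j))"

definition timelike_arclength_on :: "real set \<Rightarrow> (real \<Rightarrow> real ^ 3) \<Rightarrow> bool" where
  "timelike_arclength_on I \<gamma> \<longleftrightarrow> (\<forall>s\<in>I. hh_g (\<gamma> s) (velocity \<gamma> s) (velocity \<gamma> s) = -1)"

definition horizontal_on :: "real set \<Rightarrow> (real \<Rightarrow> real ^ 3) \<Rightarrow> bool" where
  "horizontal_on I \<gamma> \<longleftrightarrow> (\<forall>s\<in>I. hh_w (\<gamma> s) (velocity \<gamma> s) = 0)"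

definition non_geodesic_on :: "real set \<Rightarrow> (real \<Rightarrow> real ^ 3) \<Rightarrow> bool" where
  "non_geodesic_on I \<gamma> \<longleftrightarrow> (\<forall>s\<in>I. hh_nabla_along \<gamma> (velocity \<gamma>) s \<noteq> 0)"

definition null_vector :: "real ^ 3 \<Rightarrow> real ^ 3 \<Rightarrow> bool" where
  "null_vector p u \<longleftrightarrow> u \<noteq> 0 \<and> hh_g p u u = 0"

definition acceleration_nowhere_null_on :: "real set \<Rightarrow> (real \<Rightarrow> real ^ 3) \<Rightarrow> bool" where
  "acceleration_nowhere_null_on I \<gamma> \<longleftrightarrow>
     (\<forall>s\<in>I. \<not> null_vector (\<gamma> s) (hh_nabla_along \<gamma> (velocity \<gamma>) s))"

definition biharmonic_on :: "real set \<Rightarrow> (real \<Rightarrow> real ^ 3) \<Rightarrow> bool" where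
  "biharmonic_on I \<gamma> \<longleftrightarrow> (\<forall>s\<in>I.
     (let T = velocity \<gamma>; A = hh_nabla_along \<gamma> T in
      hh_nabla_along \<gamma> (hh_nabla_along \<gamma> A) s - hh_R (\<gamma> s) (T s) (A s) (T s) = 0))"

end

theory Submission
  imports Defs
begin

text \<open>A horizontal unit timelike curve has \<open>T = a e\<^sub>1 + b e\<^sub>2\<close> with \<open>a\<^sup>2 - b\<^sup>2 = -1\<close>, and
  \<open>\<nabla>\<^sub>T T = \<kappa> N\<close> with \<open>N = b e\<^sub>1 + a e\<^sub>2\<close>, \<open>\<nabla>\<^sub>T N = \<kappa> T - e\<^sub>3\<close> and \<open>\<nabla>\<^sub>T e\<^sub>3 = - N\<close>. As
  \<open>R(T, N)T = - 3 N\<close>, the biharmonic equation reads \<open>\<kappa>'' + \<kappa>\<^sup>3 + 4 \<kappa> = 0\<close>, \<open>\<kappa> \<kappa>' = 0\<close>,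
  \<open>\<kappa>' = 0\<close>, which forces \<open>\<kappa> = 0\<close>. In coordinates this is short, because
  \<open>T\<close>, \<open>\<nabla>\<^sub>T T\<close> and \<open>\<nabla>\<^sub>T \<nabla>\<^sub>T T\<close> of a horizontal curve are just its coordinate derivatives.\<close>

text \<open>In the frame \<open>e\<^sub>1, e\<^sub>2, e\<^sub>3\<close> of the paper, \<open>hh_J p u = u\<^sub>2 e\<^sub>1 + u\<^sub>1 e\<^sub>2\<close>.\<close>

definition hh_J :: "real ^ 3 \<Rightarrow> real ^ 3 \<Rightarrow> real ^ 3" where
  "hh_J p u = vector [u $ 2, u $ 1, 2 * p $ 1 * u $ 1 - 2 * p $ 2 * u $ 2]"

text \<open>Closed form of the contraction of the Christoffel symbols with \<open>u\<close> and
  \<open>v\<close>. Each summand carries a factor \<open>hh_w\<close>, so it vanishes when both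
  vectors are horizontal.\<close>

definition hh_christoffel :: "real ^ 3 \<Rightarrow> real ^ 3 \<Rightarrow> real ^ 3 \<Rightarrow> real ^ 3" where
  "hh_christoffel p u v = - (1 / 2) *\<^sub>R (hh_w p v *\<^sub>R hh_J p u + hh_w p u *\<^sub>R hh_J p v)"

lemma hh_J_nth [simp]:
  "hh_J p u $ 1 = u $ 2" "hh_J p u $ 2 = u $ 1"
  "hh_J p u $ 3 = 2 * p $ 1 * u $ 1 - 2 * p $ 2 * u $ 2"
  by (simp_all add: hh_J_def)

lemma hh_w_J [simp]: "hh_w p (hh_J p u) = 0"
  by (simp add: hh_w_def algebra_simps)

lemma hh_christoffel_zero [simp]: "hh_christoffel p 0 v = 0" "hh_christoffel p v 0 = 0"
  by (simp_all add: hh_christoffel_def hh_w_def vec_eq_iff forall_3)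

lemma hh_gram_nth:
  "hh_gram p $ i $ j = axis i 1 $ 1 * axis j 1 $ 1 - axis i 1 $ 2 * axis j 1 $ 2
     - 1 / 4 * hh_w p (axis i 1) * hh_w p (axis j 1)"
  by (simp add: hh_gram_def hh_g_def)

text \<open>The inverse metric: the sum of the squares of the orthonormal frame vectors, weighted by
  their signs 1, -1, -1.\<close>

definition hh_gram_inv :: "real ^ 3 \<Rightarrow> real ^ 3 ^ 3" where
  "hh_gram_inv p = vector [vector [1, 0, - 2 * p $ 2], vector [0, - 1, - 2 * p $ 1],
     vector [- 2 * p $ 2, - 2 * p $ 1, 4 * (p $ 2)\<^sup>2 - 4 * (p $ 1)\<^sup>2 - 4]]"

lemma matrix_inv_hh_gram: "matrix_inv (hh_gram p) = hh_gram_inv p"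
proof -
  have l: "hh_gram_inv p ** hh_gram p = mat 1" and r: "hh_gram p ** hh_gram_inv p = mat 1"
    by (simp_all add: vec_eq_iff forall_3 matrix_matrix_mult_def mat_def sum_3 hh_gram_nth hh_w_def
        axis_def hh_gram_inv_def power2_eq_square field_simps)
  \<comment> \<open>\<open>matrix_inv\<close> is a Hilbert choice, so a two-sided inverse must be
    exhibited before its defining property is available.\<close>
  then have "matrix_inv (hh_gram p) ** hh_gram p = mat 1"
    unfolding matrix_inv_def by (metis (mono_tags, lifting) someI_ex)
  then show ?thesis
    by (metis r matrix_mul_assoc matrix_mul_lid matrix_mul_rid)
qed

lemma hh_w_add_scaleR_left:
  "hh_w (p + t *\<^sub>R v) u = hh_w p u + t * (2 * v $ 2 * u $ 1 - 2 * v $ 1 * u $ 2)"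
  by (simp add: hh_w_def algebra_simps)

lemma partial_hh_gram:
  "partial i (\<lambda>q. hh_gram q $ j $ l) p =
     - (1 / 4) * ((2 * axis i 1 $ 2 * axis j 1 $ 1 - 2 * axis i 1 $ 1 * axis j 1 $ 2) * hh_w p (axis l 1)
      + (2 * axis i 1 $ 2 * axis l 1 $ 1 - 2 * axis i 1 $ 1 * axis l 1 $ 2) * hh_w p (axis j 1))"
  unfolding partial_def hh_gram_nth hh_w_add_scaleR_left
  by (rule DERIV_imp_deriv) (auto intro!: derivative_eq_intros simp: algebra_simps)

lemma sum_hh_Gamma:
  "(\<Sum>i\<in>UNIV. \<Sum>j\<in>UNIV. hh_Gamma p k i j * u $ i * v $ j) = hh_christoffel p u v $ k"
proof -
  have "\<forall>k. (\<Sum>i\<in>UNIV. \<Sum>j\<in>UNIV. hh_Gamma p k i j * u $ i * v $ j) = hh_christoffel p u v $ k"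
    unfolding forall_3
    by (simp add: sum_3 hh_Gamma_def matrix_inv_hh_gram hh_gram_inv_def partial_hh_gram
        hh_christoffel_def hh_w_def axis_def field_simps power2_eq_square)
  then show ?thesis by blast
qed

lemma hh_nabla_eq:
  "hh_nabla X Y p = (\<chi> k. \<Sum>i\<in>UNIV. X p $ i * partial i (\<lambda>q. Y q $ k) p) + hh_christoffel p (X p) (Y p)"
  by (simp add: hh_nabla_def sum_hh_Gamma vec_eq_iff)

lemma partial_const [simp]: "partial i (\<lambda>_. c) p = 0"
  by (simp add: partial_def)

lemma hh_nabla_const: "hh_nabla (\<lambda>_. u) (\<lambda>_. v) p = hh_christoffel p u v"
  by (simp add: hh_nabla_eq vec_eq_iff)

lemma lie_bracket_const: "lie_bracket (\<lambda>_. u) (\<lambda>_. v) = (\<lambda>_. 0)"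
  by (simp add: lie_bracket_def vec_eq_iff fun_eq_iff)

lemma hh_J_add_scaleR_left:
  "hh_J (p + t *\<^sub>R v) u = hh_J p u + t *\<^sub>R axis 3 (2 * v $ 1 * u $ 1 - 2 * v $ 2 * u $ 2)"
  by (simp add: vec_eq_iff forall_3 axis_def algebra_simps)

text \<open>By the product rule, only the terms that differentiate a factor \<open>hh_w\<close>
  survive at a point where both factors vanish.\<close>

lemma partial_hh_christoffel:
  assumes "hh_w p u = 0" "hh_w p v = 0"
  shows "partial i (\<lambda>q. hh_christoffel q u v $ k) p =
    (axis i 1 $ 1 * v $ 2 - axis i 1 $ 2 * v $ 1) * hh_J p u $ k
    + (axis i 1 $ 1 * u $ 2 - axis i 1 $ 2 * u $ 1) * hh_J p v $ k"
  unfolding partial_def hh_christoffel_def hh_w_add_scaleR_left hh_J_add_scaleR_left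
  by (rule DERIV_imp_deriv) (auto intro!: derivative_eq_intros simp: assms algebra_simps)

lemma hh_nabla_hh_christoffel:
  assumes "hh_w p u = 0" "hh_w p v = 0"
  shows "hh_nabla (\<lambda>_. w) (\<lambda>q. hh_christoffel q u v) p =
    (w $ 1 * v $ 2 - w $ 2 * v $ 1) *\<^sub>R hh_J p u + (w $ 1 * u $ 2 - w $ 2 * u $ 1) *\<^sub>R hh_J p v"
proof -
  have 0: "hh_christoffel p u v = 0"
    using assms by (simp add: hh_christoffel_def)
  show ?thesis
    by (simp add: hh_nabla_eq 0 partial_hh_christoffel [OF assms] vec_eq_iff sum_3 axis_def
       algebra_simps)
qed

text \<open>The constant extensions commute, so no bracket term appears. The nested derivative along
  \<open>u\<close> contributes one copy of the area factor times \<open>hh_J p u\<close>, the one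
  along \<open>v\<close> two more.\<close>

lemma hh_R_horizontal:
  assumes "hh_w p u = 0" "hh_w p v = 0"
  shows "hh_R p u v u = (3 * (u $ 1 * v $ 2 - u $ 2 * v $ 1)) *\<^sub>R hh_J p u"
proof -
  have 0: "hh_nabla (\<lambda>_. 0) (\<lambda>_. u) p = 0"
    by (simp add: hh_nabla_const)
  show ?thesis
    unfolding hh_R_def hh_curvature_field_def hh_nabla_const lie_bracket_const 0
      hh_nabla_hh_christoffel [OF assms(2,1)] hh_nabla_hh_christoffel [OF assms(1,1)]
    by (simp add: vec_eq_iff algebra_simps)
qed

lemma hh_nabla_along_eq:
  "hh_nabla_along \<gamma> V s = velocity V s + hh_christoffel (\<gamma> s) (velocity \<gamma> s) (V s)"
  by (simp add: hh_nabla_along_def sum_hh_Gamma vec_eq_iff)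

lemma velocity_cong_open:
  assumes "open I" "s \<in> I" "\<And>t. t \<in> I \<Longrightarrow> f t = g t"
  shows "velocity f s = velocity g s"
proof -
  have "eventually (\<lambda>t. f t = g t) (nhds s)"
    using assms eventually_nhds by blast
  then show ?thesis
    unfolding velocity_def by (intro vector_derivative_cong_eq) (auto simp: assms)
qed

text \<open>Differentiates a constraint that holds along the curve into a constraint of the next
  order.\<close>

lemma DERIV_zero_on_open:
  fixes f :: "real \<Rightarrow> real"
  assumes "open I" "s \<in> I" "\<And>t. t \<in> I \<Longrightarrow> f t = 0" "(f has_real_derivative d) (at s)"
  shows "d = 0"
proof -
  have "((\<lambda>_. 0) has_real_derivative d) (at s)"
    using assms(4,1,2) by (rule has_field_derivative_transform_within_open) (simp add: assms(3))
  then show ?thesis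
    using DERIV_unique DERIV_const by blast
qed

lemma smooth_curve_on_DERIV:
  assumes "smooth_curve_on I \<gamma>" "s \<in> I"
  shows "((\<lambda>t. (velocity ^^ n) \<gamma> t $ k) has_real_derivative (velocity ^^ Suc n) \<gamma> s $ k) (at s)"
proof -
  have "((velocity ^^ n) \<gamma> has_vector_derivative velocity ((velocity ^^ n) \<gamma>) s) (at s)"
    using assms unfolding smooth_curve_on_def velocity_def by (simp add: vector_derivative_works)
  from bounded_linear.has_vector_derivative [OF bounded_linear_vec_nth this]
  show ?thesis
    by (simp add: has_real_derivative_iff_has_vector_derivative)
qed

text \<open>The ansatz \<open>(a\<^sub>1, b\<^sub>1) = \<kappa> (b, a)\<close> with \<open>\<kappa> = b a\<^sub>1 - a b\<^sub>1\<close> turns the hypotheses into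
  \<open>\<kappa>\<^sup>3 + 4 \<kappa> = 0\<close>.\<close>

lemma biharmonic_jet_trivial:
  fixes a b a1 b1 a2 b2 a3 b3 :: real
  assumes 0: "a * a - b * b = -1" and 1: "a * a1 = b * b1"
    and 2: "a1 * a1 + a * a2 = b1 * b1 + b * b2"
    and p: "b * a2 = a * b2" and dp: "b * a3 + b1 * a2 = a * b3 + a1 * b2"
    and a3: "a3 = - 4 * (b * a1 - a * b1) * b" and b3: "b3 = - 4 * (b * a1 - a * b1) * a"
  shows "a1 = 0 \<and> b1 = 0"
proof -
  define k where "k = b * a1 - a * b1"
  have a1: "a1 = k * b" and b1: "b1 = k * a"
    unfolding k_def using 0 1 by algebra+
  \<comment> \<open>By \<open>p\<close>, (a2, b2) is a multiple of (a, b); \<open>0\<close> and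
    \<open>2\<close> fix the factor.\<close>
  have a2: "a2 = k\<^sup>2 * a" and b2: "b2 = k\<^sup>2 * b"
    using 0 2 p a1 b1 by algebra+
  \<comment> \<open>\<open>dp\<close> says that b a3 - a b3, which is -4 k, equals a1 b2 - b1 a2,
    which is k^3.\<close>
  have "k * (k\<^sup>2 + 4) = 0"
    using dp a3 b3 0 unfolding a1 b1 a2 b2 by algebra
  moreover have "k\<^sup>2 + 4 > 0" by (simp add: add_nonneg_pos)
  ultimately have "k = 0" by simp
  then show ?thesis using a1 b1 by simp
qed

theorem theorem5p2:
  "\<not> (\<exists>(I :: real set) (\<gamma> :: real \<Rightarrow> real ^ 3).
      open I \<and> is_interval I \<and> I \<noteq> {} \<and> smooth_curve_on I \<gamma> \<and>
      timelike_arclength_on I \<gamma> \<and> non_geodesic_on I \<gamma> \<and> acceleration_nowhere_null_on I \<gamma> \<and>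
      horizontal_on I \<gamma> \<and> biharmonic_on I \<gamma>)"
proof (rule notI, elim exE conjE)
  fix I :: "real set" and \<gamma> :: "real \<Rightarrow> real ^ 3"
  assume I: "open I" "I \<noteq> {}" and smooth: "smooth_curve_on I \<gamma>"
    and timelike: "timelike_arclength_on I \<gamma>" and ng: "non_geodesic_on I \<gamma>"
    and hor: "horizontal_on I \<gamma>" and bih: "biharmonic_on I \<gamma>"
  define T where "T = velocity \<gamma>"
  define A where "A = velocity T"
  define B where "B = velocity A"
  define C where "C = velocity B"
  have deriv: "((\<lambda>t. \<gamma> t $ k) has_real_derivative T s $ k) (at s)"
    "((\<lambda>t. T t $ k) has_real_derivative A s $ k) (at s)"
    "((\<lambda>t. A t $ k) has_real_derivative B s $ k) (at s)"
    "((\<lambda>t. B t $ k) has_real_derivative C s $ k) (at s)" if "s \<in> I" for s k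
    using smooth_curve_on_DERIV [OF smooth that, of 0 k] smooth_curve_on_DERIV [OF smooth that, of 1 k]
      smooth_curve_on_DERIV [OF smooth that, of 2 k] smooth_curve_on_DERIV [OF smooth that, of 3 k]
    by (simp_all add: T_def A_def B_def C_def eval_nat_numeral)
  note vanish = DERIV_zero_on_open [OF I(1)]

  have wT: "hh_w (\<gamma> s) (T s) = 0" if "s \<in> I" for s
    using hor that by (simp add: horizontal_on_def T_def)
  have wA: "hh_w (\<gamma> s) (A s) = 0" if s: "s \<in> I" for s
    unfolding hh_w_def
    by (rule vanish [OF s wT [unfolded hh_w_def]], assumption)
      (auto intro!: derivative_eq_intros deriv s simp: algebra_simps)
  \<comment> \<open>Differentiation also hits the base point of \<open>hh_w\<close>. For
    \<open>wA\<close> that extra term cancels by antisymmetry; here it survives, so \<open>B\<close>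
    need not be horizontal.\<close>
  have wB: "hh_w (\<gamma> s) (B s) = 2 * (T s $ 1 * A s $ 2 - T s $ 2 * A s $ 1)" if s: "s \<in> I" for s
  proof -
    have "hh_w (\<gamma> s) (B s) - 2 * (T s $ 1 * A s $ 2 - T s $ 2 * A s $ 1) = 0"
      unfolding hh_w_def
      by (rule vanish [OF s wA [unfolded hh_w_def]], assumption)
        (auto intro!: derivative_eq_intros deriv s simp: algebra_simps)
    then show ?thesis by simp
  qed

  have acc: "hh_nabla_along \<gamma> T s = A s" if "s \<in> I" for s
    by (simp add: hh_nabla_along_eq T_def [symmetric] A_def [symmetric] hh_christoffel_def wT that)
  have jerk: "hh_nabla_along \<gamma> (hh_nabla_along \<gamma> T) s = B s" if s: "s \<in> I" for s
    using velocity_cong_open [OF I(1) s acc]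
    by (simp add: hh_nabla_along_eq [of \<gamma> "hh_nabla_along \<gamma> T"] T_def [symmetric] B_def [symmetric]
        hh_christoffel_def wT wA acc s)
  \<comment> \<open>The vertical part of \<open>B\<close> makes the connection contribute for the
    first time.\<close>
  have snap: "hh_nabla_along \<gamma> (hh_nabla_along \<gamma> (hh_nabla_along \<gamma> T)) s =
      C s + (T s $ 2 * A s $ 1 - T s $ 1 * A s $ 2) *\<^sub>R hh_J (\<gamma> s) (T s)" if s: "s \<in> I" for s
    using velocity_cong_open [OF I(1) s jerk]
    by (simp add: hh_nabla_along_eq [of \<gamma> "hh_nabla_along \<gamma> (hh_nabla_along \<gamma> T)"]
        T_def [symmetric] C_def [symmetric] hh_christoffel_def wT wB jerk s algebra_simps)
  have C: "C s = (- 4 * (T s $ 2 * A s $ 1 - T s $ 1 * A s $ 2)) *\<^sub>R hh_J (\<gamma> s) (T s)"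
    if s: "s \<in> I" for s
  proof -
    have "C s + (T s $ 2 * A s $ 1 - T s $ 1 * A s $ 2) *\<^sub>R hh_J (\<gamma> s) (T s)
        - (3 * (T s $ 1 * A s $ 2 - T s $ 2 * A s $ 1)) *\<^sub>R hh_J (\<gamma> s) (T s) = 0"
      using bih s by (simp add: biharmonic_on_def Let_def T_def [symmetric] snap acc hh_R_horizontal wT wA)
    moreover have "C s + (T s $ 2 * A s $ 1 - T s $ 1 * A s $ 2) *\<^sub>R hh_J (\<gamma> s) (T s)
        - (3 * (T s $ 1 * A s $ 2 - T s $ 2 * A s $ 1)) *\<^sub>R hh_J (\<gamma> s) (T s)
      = C s - (- 4 * (T s $ 2 * A s $ 1 - T s $ 1 * A s $ 2)) *\<^sub>R hh_J (\<gamma> s) (T s)"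
      by (simp add: vec_eq_iff algebra_simps)
    ultimately show ?thesis by simp
  qed

  have 0: "T s $ 1 * T s $ 1 - T s $ 2 * T s $ 2 + 1 = 0" if "s \<in> I" for s
    using timelike that by (simp add: timelike_arclength_on_def T_def [symmetric] hh_g_def wT)
  have 1: "T s $ 1 * A s $ 1 - T s $ 2 * A s $ 2 = 0" if s: "s \<in> I" for s
  proof -
    have "2 * (T s $ 1 * A s $ 1 - T s $ 2 * A s $ 2) = 0"
      by (rule vanish [OF s 0], assumption)
        (auto intro!: derivative_eq_intros deriv s simp: algebra_simps)
    then show ?thesis by simp
  qed
  have 2: "A s $ 1 * A s $ 1 + T s $ 1 * B s $ 1 - (A s $ 2 * A s $ 2 + T s $ 2 * B s $ 2) = 0"
    if s: "s \<in> I" for s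
    by (rule vanish [OF s 1], assumption)
      (auto intro!: derivative_eq_intros deriv s simp: algebra_simps)
  text \<open>The derivative of \<open>wB\<close>, as \<open>C\<close> is horizontal.\<close>
  have p: "T s $ 2 * B s $ 1 - T s $ 1 * B s $ 2 = 0" if s: "s \<in> I" for s
  proof -
    have "hh_w (\<gamma> t) (B t) - 2 * (T t $ 1 * A t $ 2 - T t $ 2 * A t $ 1) = 0" if "t \<in> I" for t
      by (simp add: wB that)
    note w = this [unfolded hh_w_def]
    have "hh_w (\<gamma> s) (C s) + 4 * (T s $ 2 * B s $ 1 - T s $ 1 * B s $ 2) = 0"
      unfolding hh_w_def
      by (rule vanish [OF s w], assumption)
        (auto intro!: derivative_eq_intros deriv s simp: algebra_simps)
    moreover have "hh_w (\<gamma> s) (C s) = 0"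
      using hh_w_J [of "\<gamma> s" "T s"] unfolding C [OF s] by (simp add: hh_w_def algebra_simps)
    ultimately show ?thesis by simp
  qed
  \<comment> \<open>With \<kappa> = b a1 - a b1, \<open>p\<close> is \<kappa>' = 0 and this is
    \<kappa>'' = 0.\<close>
  have dp: "T s $ 2 * C s $ 1 + A s $ 2 * B s $ 1 - (T s $ 1 * C s $ 2 + A s $ 1 * B s $ 2) = 0"
    if s: "s \<in> I" for s
    by (rule vanish [OF s p], assumption)
      (auto intro!: derivative_eq_intros deriv s simp: algebra_simps)

  obtain s where s: "s \<in> I" using I(2) by blast
  have "A s $ 1 = 0 \<and> A s $ 2 = 0"
    by (rule biharmonic_jet_trivial [where a = "T s $ 1" and b = "T s $ 2"
            and ?a2.0 = "B s $ 1" and ?b2.0 = "B s $ 2" and ?a3.0 = "C s $ 1" and ?b3.0 = "C s $ 2"])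
      (use 0 [OF s] 1 [OF s] 2 [OF s] p [OF s] dp [OF s] C [OF s] in \<open>simp_all add: mult_ac\<close>)
  \<comment> \<open>A horizontal vector is determined by its first two components.\<close>
  then have "A s = 0"
    using wA [OF s] by (simp add: hh_w_def vec_eq_iff forall_3)
  moreover have "A s \<noteq> 0"
    using ng s acc by (simp add: non_geodesic_on_def T_def [symmetric])
  ultimately show False by simp
qed

end
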